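(* Let $\Bbbk$ be a field of characteristic $0$. In the free nonsymmetric (magma) operad over $\Bbbk$ generated by two binary operations $x$ and $y$, the three rewriting rules $$x\bigl(y( *\; * )\; *\bigr)\rightsquigarrow y\bigl( *\; x( *\; * )\bigr),$$ $$y\bigl(y( *\; * )\; *\bigr)\rightsquigarrow -y\bigl(x( *\; * )\; *\bigr)-x\bigl(x( *\; * )\; *\bigr)+y\bigl( *\; y( *\; * )\bigr)+x\bigl( *\; y( *\; * )\bigr)+x\bigl( *\; x( *\; * )\bigr),$$ $$x\bigl(x(x( *\; * )\; * )\; *\bigr)\rightsquigarrow x\bigl(x( *\; y( *\; * ))\; *\bigr)+x\bigl(x( *\; x( *\; * ))\; *\bigr)+x\bigl(x( *\; * )\; x( *\; * )\bigr)-x\bigl( *\; y( *\; x( *\; * ))\bigr)-x\bigl( *\; x( *\; x( *\; * ))\bigr)$$ form a Gröbner–Shirshov basis (with the left-hand sides as leading monomials).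
   Context: Monomials of the free nonsymmetric operad on two binary generators $x,y$ are planar binary trees with internal vertices labelled $x$ or $y$; $x(u\;v)$ denotes the tree with root $x$, left subtree $u$ and right subtree $v$, and $*$ denotes a leaf (an input). In a rule, the leaves $*$ are read from left to right in the same order on both sides, and arbitrary trees may be substituted for them. A system of rewriting rules (left-hand side monomial $\rightsquigarrow$ linear combination of smaller monomials) is a Gröbner–Shirshov basis if the left-hand sides are the leading monomials with respect to some monomial order on tree monomials and every critical composition (i.e. the difference of the two results of rewriting a tree monomial that is a minimal overlap of two left-hand sides) reduces to zero by means of the rules. Equivalently, the tree monomials that contain no left-hand side as a subtree pattern form a linear basis of the quotient of the free nonsymmetric operad by the operadic ideal generated by all differences (left-hand side) $-$ (right-hand side). (The first two rules are the defining relations of the nonsymmetric operad $\mathrm{pre}\text{-}\mathrm{As}^{\mathrm I}$ of initial pre-associative algebras, with $x$ corresponding to $\prec$ and $y$ to $\succ$.) *)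

theory Defs
  imports "HOL-Library.Tree" "HOL-Library.Poly_Mapping"
begin

text \<open>
  Tree monomials are the library's labelled binary trees \<^typ>\<open>'g tree\<close>, where
  \<^term>\<open>Node u g v\<close> has root label \<open>g\<close>, left subtree \<open>u\<close> and right subtree \<open>v\<close>.
  The arity of a monomial (its number of leaves) is \<^const>\<open>size1\<close>.
  Elements of the free nonsymmetric operad on binary generators \<open>'g\<close> are finitely supported
  functions from tree monomials to scalars.
\<close>

text \<open>
  Operadic composition \<open>\<gamma>(t; us\<^sub>0, us\<^sub>1, \<dots>)\<close>: the leaves of \<open>t\<close>, read from left to right, are
  replaced by the entries of \<open>us\<close>. It is meaningful only when \<^prop>\<open>length us = size1 t\<close>.
\<close>

fun graft :: "'g tree \<Rightarrow> 'g tree list \<Rightarrow> 'g tree" where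
  "graft Leaf us = hd us"
| "graft (Node l g r) us =
     Node (graft l (take (size1 l) us)) g (graft r (drop (size1 l) us))"

datatype dir = Left | Right

type_synonym pos = "dir list"

fun subtree_at :: "'g tree \<Rightarrow> pos \<Rightarrow> 'g tree option" where
  "subtree_at t [] = Some t"
| "subtree_at Leaf (d # p) = None"
| "subtree_at (Node l g r) (Left # p) = subtree_at l p"
| "subtree_at (Node l g r) (Right # p) = subtree_at r p"

text \<open>Only used at positions that exist in the tree; elsewhere the tree is left unchanged.\<close>

fun replace_at :: "'g tree \<Rightarrow> pos \<Rightarrow> 'g tree \<Rightarrow> 'g tree" where
  "replace_at t [] u = u"
| "replace_at Leaf (d # p) u = Leaf"
| "replace_at (Node l g r) (Left # p) u = Node (replace_at l p u) g r"
| "replace_at (Node l g r) (Right # p) u = Node l g (replace_at r p u)"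

definition internal_vertices :: "'g tree \<Rightarrow> pos set" where
  "internal_vertices t = {p. \<exists>l g r. subtree_at t p = Some (Node l g r)}"

text \<open>
  Monomials are only compared within one arity: \<open>ord n\<close> is a reflexive order on the monomials of
  arity \<open>n\<close>, with \<open>(s, t) \<in> ord n\<close> meaning \<open>s \<le> t\<close>. It is required to be a well-order, and every
  operadic composition of monomials has to be strictly increasing in each of its arguments.
\<close>

definition monomial_order :: "(nat \<Rightarrow> 'g tree rel) \<Rightarrow> bool" where
  "monomial_order ord \<longleftrightarrow>
     (\<forall>n. well_order_on {t. size1 t = n} (ord n)) \<and>
     (\<forall>n s s' us. (s, s') \<in> ord n - Id \<longrightarrow> length us = n \<longrightarrow>
        (graft s us, graft s' us) \<in> ord (size1 (graft s us)) - Id) \<and>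
     (\<forall>n t us i s'. length us = size1 t \<longrightarrow> i < length us \<longrightarrow> (us ! i, s') \<in> ord n - Id \<longrightarrow>
        (graft t us, graft t (us[i := s'])) \<in> ord (size1 (graft t us)) - Id)"

text \<open>A rewriting rule: a left-hand side monomial and a right-hand side linear combination.\<close>

type_synonym ('g, 'k) rule = "'g tree \<times> ('g tree \<Rightarrow>\<^sub>0 'k)"

definition lin_ext :: "('a \<Rightarrow> 'b) \<Rightarrow> ('a \<Rightarrow>\<^sub>0 'k) \<Rightarrow> ('b \<Rightarrow>\<^sub>0 'k::comm_monoid_add)" where
  "lin_ext f p = (\<Sum>a\<in>Poly_Mapping.keys p. Poly_Mapping.single (f a) (Poly_Mapping.lookup p a))"

text \<open>
  \<open>rewrites_at \<rho> p T h\<close>: the left-hand side of \<open>\<rho>\<close> occurs in the monomial \<open>T\<close> with its root at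
  position \<open>p\<close>, and \<open>h\<close> is the result of rewriting that occurrence. The leaves of the
  left-hand side and of each right-hand side monomial carry, from left to right, the same
  trees \<open>us\<close>.
\<close>

inductive rewrites_at ::
  "('g, 'k::comm_monoid_add) rule \<Rightarrow> pos \<Rightarrow> 'g tree \<Rightarrow> ('g tree \<Rightarrow>\<^sub>0 'k) \<Rightarrow> bool" where
  "subtree_at T p = Some (graft l us) \<Longrightarrow> length us = size1 l \<Longrightarrow>
     rewrites_at (l, r) p T (lin_ext (\<lambda>m. replace_at T p (graft m us)) r)"

text \<open>One reduction step: a monomial of \<open>f\<close> is replaced, with its coefficient.\<close>

inductive reduction_step ::
  "('g, 'k::field) rule set \<Rightarrow> ('g tree \<Rightarrow>\<^sub>0 'k) \<Rightarrow> ('g tree \<Rightarrow>\<^sub>0 'k) \<Rightarrow> bool"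
  for R :: "('g, 'k) rule set" where
  "\<rho> \<in> R \<Longrightarrow> T \<in> Poly_Mapping.keys f \<Longrightarrow> rewrites_at \<rho> p T h \<Longrightarrow>
     reduction_step R f
       (f - Poly_Mapping.map ((*) (Poly_Mapping.lookup f T)) (Poly_Mapping.single T 1 - h))"

definition reduces_to_zero ::
  "('g, 'k::field) rule set \<Rightarrow> ('g tree \<Rightarrow>\<^sub>0 'k) \<Rightarrow> bool" where
  "reduces_to_zero R f \<longleftrightarrow> (reduction_step R)\<^sup>*\<^sup>* f 0"

definition occurrence_vertices :: "'g tree \<Rightarrow> pos \<Rightarrow> pos set" where
  "occurrence_vertices l p = (\<lambda>q. p @ q) ` internal_vertices l"

text \<open>
  Critical compositions come from monomials \<open>T\<close> that are minimal overlaps of two distinct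
  occurrences of left-hand sides: the occurrences share an internal vertex, and together they
  cover all internal vertices of \<open>T\<close>.
\<close>

inductive critical_composition ::
  "('g, 'k::field) rule set \<Rightarrow> ('g tree \<Rightarrow>\<^sub>0 'k) \<Rightarrow> bool"
  for R :: "('g, 'k) rule set" where
  "\<rho>\<^sub>1 \<in> R \<Longrightarrow> \<rho>\<^sub>2 \<in> R \<Longrightarrow> (\<rho>\<^sub>1, p\<^sub>1) \<noteq> (\<rho>\<^sub>2, p\<^sub>2) \<Longrightarrow>
   rewrites_at \<rho>\<^sub>1 p\<^sub>1 T h\<^sub>1 \<Longrightarrow> rewrites_at \<rho>\<^sub>2 p\<^sub>2 T h\<^sub>2 \<Longrightarrow>
   occurrence_vertices (fst \<rho>\<^sub>1) p\<^sub>1 \<inter> occurrence_vertices (fst \<rho>\<^sub>2) p\<^sub>2 \<noteq> {} \<Longrightarrow>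
   occurrence_vertices (fst \<rho>\<^sub>1) p\<^sub>1 \<union> occurrence_vertices (fst \<rho>\<^sub>2) p\<^sub>2 = internal_vertices T \<Longrightarrow>
   critical_composition R (h\<^sub>1 - h\<^sub>2)"

definition groebner_shirshov_basis :: "('g, 'k::field) rule set \<Rightarrow> bool" where
  "groebner_shirshov_basis R \<longleftrightarrow>
     (\<exists>ord. monomial_order ord \<and>
        (\<forall>(l, r)\<in>R. \<forall>m\<in>Poly_Mapping.keys r. (m, l) \<in> ord (size1 l) - Id)) \<and>
     (\<forall>f. critical_composition R f \<longrightarrow> reduces_to_zero R f)"

datatype gen = Gen_x | Gen_y

abbreviation x_tree :: "gen tree \<Rightarrow> gen tree \<Rightarrow> gen tree" ("\<x>'(_ _')" [1000, 1000] 1000) where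
  "\<x>(u v) \<equiv> Node u Gen_x v"

abbreviation y_tree :: "gen tree \<Rightarrow> gen tree \<Rightarrow> gen tree" ("\<y>'(_ _')" [1000, 1000] 1000) where
  "\<y>(u v) \<equiv> Node u Gen_y v"

abbreviation input_leaf :: "gen tree" ("\<star>") where
  "\<star> \<equiv> Leaf"

abbreviation monomial :: "gen tree \<Rightarrow> (gen tree \<Rightarrow>\<^sub>0 'k::field)" ("\<lbrakk>_\<rbrakk>") where
  "\<lbrakk>t\<rbrakk> \<equiv> Poly_Mapping.single t 1"

end

theory Submission
  imports Defs
begin

text \<open>
  The order compares the sequences of root-to-leaf label words lexicographically, the words
  themselves being compared first by length and then lexicographically with \<open>x < y\<close>. Grafting acts
  on these words by concatenation, hence is strictly increasing in every argument.

  All left-hand sides are left combs, with labels \<open>xy\<close>, \<open>yy\<close> and \<open>xxx\<close> read from the root, so the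
  minimal overlaps are the left combs \<open>xyy\<close>, \<open>yyy\<close>, \<open>xxxx\<close>, \<open>xxxy\<close> and \<open>xxxxx\<close>. Their
  compositions have integer coefficients and are reduced to zero by a verified rewriting function
  on lists of terms, evaluated in the logic.
\<close>

section \<open>The path order\<close>

fun leaf_words :: "'g tree \<Rightarrow> 'g list list" where
  "leaf_words Leaf = [[]]"
| "leaf_words (Node l g r) = map ((#) g) (leaf_words l @ leaf_words r)"

lemma length_leaf_words [simp]: "length (leaf_words t) = size1 t"
  by (induction t) auto

lemma leaf_words_nonempty: "leaf_words t \<noteq> []"
  by (induction t) auto

text \<open>
  The common prefix \<open>w\<close> and the tails \<open>us\<close>, \<open>vs\<close> make the induction go through: the labels of the
  left subtree are consumed first, then those of the right one.
\<close>

lemma leaf_words_append_inject: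
  "map ((@) w) (leaf_words s) @ us = map ((@) w) (leaf_words t) @ vs \<Longrightarrow> s = t \<and> us = vs"
proof (induction s arbitrary: t w us vs)
  case Leaf
  show ?case
  proof (cases t)
    case (Node l g r)
    obtain v ws where "leaf_words l = v # ws"
      using leaf_words_nonempty by (meson neq_Nil_conv)
    with Leaf Node show ?thesis by simp
  qed (use Leaf in simp)
next
  case (Node l g r)
  have comp: "map ((@) w \<circ> (#) h) ws = map ((@) (w @ [h])) ws" for h :: 'a and w ws
    by simp
  show ?case
  proof (cases t)
    case Leaf
    obtain v ws where "leaf_words l = v # ws"
      using leaf_words_nonempty by (meson neq_Nil_conv)
    with Leaf Node.prems show ?thesis by simp
  next
    case t: (Node l' g' r')
    obtain v ws v' ws' where *: "leaf_words l = v # ws" "leaf_words l' = v' # ws'"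
      using leaf_words_nonempty by (meson neq_Nil_conv)
    \<comment> \<open>Both first words consist of \<open>w\<close>, then a root label, then the
      rest; comparing the letters right after \<open>w\<close> identifies the labels.\<close>
    have "g = g'"
      using Node.prems by (simp add: t *)
    with Node.prems t
    have "map ((@) (w @ [g])) (leaf_words l) @ (map ((@) (w @ [g])) (leaf_words r) @ us) =
          map ((@) (w @ [g])) (leaf_words l') @ (map ((@) (w @ [g])) (leaf_words r') @ vs)"
      by (simp add: comp)
    from Node.IH(1)[OF this] Node.IH(2) show ?thesis
      using t \<open>g = g'\<close> by blast
  qed
qed

lemma leaf_words_inject: "leaf_words s = leaf_words t \<longleftrightarrow> s = t"
  using leaf_words_append_inject[of "[]" s "[]" t "[]"] by auto

section \<open>Grafting expressed on lists of leaf words\<close>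

definition graft_words :: "'g list list \<Rightarrow> 'g tree list \<Rightarrow> 'g list list" where
  "graft_words ws us = concat (map2 (\<lambda>w u. map ((@) w) (leaf_words u)) ws us)"

lemma graft_words_simps [simp]:
  "graft_words [] us = []"
  "graft_words ws [] = []"
  "graft_words (w # ws) (u # us) = map ((@) w) (leaf_words u) @ graft_words ws us"
  by (simp_all add: graft_words_def)

lemma graft_words_append:
  "length ws = length us \<Longrightarrow> graft_words (ws @ ws') (us @ us') = graft_words ws us @ graft_words ws' us'"
  by (simp add: graft_words_def)

lemma graft_words_map_Cons:
  "graft_words (map ((#) g) ws) us = map ((#) g) (graft_words ws us)"
proof (induction us arbitrary: ws)
  case (Cons u us)
  then show ?case by (cases ws) auto
qed simp

text \<open>A path to a leaf of the composite runs through \<open>t\<close> to one of its leaves and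
  then through the tree put there. Since \<open>graft_words\<close> accepts arbitrary word lists,
  monotonicity can be proved by list induction, away from tree shapes.\<close>

lemma leaf_words_graft:
  "length us = size1 t \<Longrightarrow> leaf_words (graft t us) = graft_words (leaf_words t) us"
proof (induction t arbitrary: us)
  case Leaf
  then obtain u where "us = [u]" by (auto simp: length_Suc_conv)
  then show ?case by (simp add: map_idI)
next
  case (Node l g r)
  define us1 us2 where "us1 = take (size1 l) us" and "us2 = drop (size1 l) us"
  have us: "us = us1 @ us2"
    by (simp add: us1_def us2_def)
  have len: "length us1 = size1 l" "length us2 = size1 r"
    using Node.prems by (simp_all add: us1_def us2_def)
  have "leaf_words (graft (Node l g r) us) =
      map ((#) g) (leaf_words (graft l us1) @ leaf_words (graft r us2))"
    by (simp add: us1_def us2_def)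
  also have "\<dots> = graft_words (leaf_words (Node l g r)) us"
    unfolding us using Node.IH len by (simp add: graft_words_append graft_words_map_Cons)
  finally show ?case .
qed

lemma length_graft_words:
  "length ws = length us \<Longrightarrow> length (graft_words ws us) = (\<Sum>u\<leftarrow>us. size1 u)"
  by (induction ws us rule: list_induct2) auto

section \<open>Strict monotonicity of grafting\<close>

lemma lenlex_map_append:
  assumes "irrefl R"
  shows "(map ((@) w) us, map ((@) w) vs) \<in> lenlex (lenlex R) \<longleftrightarrow> (us, vs) \<in> lenlex (lenlex R)"
proof (induction us arbitrary: vs)
  case Nil
  then show ?case by (cases vs) auto
next
  case (Cons u us)
  then show ?case using assms by (cases vs) (auto simp: Cons_lenlex_iff)
qed

text \<open>At the first differing words \<open>x\<close> and \<open>y\<close>, the grafted lists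
  first differ in \<open>x @ v\<close> and \<open>y @ v\<close>, with \<open>v\<close> the first
  leaf word of the tree put there. Comparing words by length first makes the order survive the
  common suffix \<open>v\<close>; a purely lexicographic order would fail when \<open>x\<close> is a
  prefix of \<open>y\<close>. The later words do not matter because both lists have the same
  length.\<close>

lemma graft_words_strict_mono_left:
  assumes "irrefl R" "length ws = length us" "length ws' = length us"
    "(ws, ws') \<in> lenlex (lenlex R)"
  shows "(graft_words ws us, graft_words ws' us) \<in> lenlex (lenlex R)"
  using assms(2-)
proof (induction us arbitrary: ws ws')
  case (Cons u us)
  from Cons.prems obtain x xs y ys where xy: "ws = x # xs" "ws' = y # ys"
      "length xs = length us" "length ys = length us"
    by (auto simp: length_Suc_conv)
  have irr: "irrefl (lenlex R)"
    using assms(1) by (meson irreflI irreflD lenlex_irreflexive)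
  from Cons.prems consider "(x, y) \<in> lenlex R" | "x = y" "(xs, ys) \<in> lenlex (lenlex R)"
    by (auto simp: xy Cons_lenlex_iff)
  then show ?case
  proof cases
    case 1
    obtain v vs where "leaf_words u = v # vs"
      using leaf_words_nonempty by (meson neq_Nil_conv)
    with 1 show ?thesis
      by (simp add: xy Cons_lenlex_iff length_graft_words lenlex_append1)
  next
    case 2
    with Cons.IH[of xs ys] irr show ?thesis
      by (simp add: xy)
  qed
qed simp

text \<open>Only the block contributed by entry \<open>i\<close> changes. The blocks before it
  cancel by irreflexivity, prefixing by \<open>x\<close> preserves the comparison inside it, and
  equal arity keeps the lengths aligned, so the blocks after it have no influence.\<close>

lemma graft_words_strict_mono_right:
  assumes "irrefl R" "length ws = length us" "i < length us" "size1 (us ! i) = size1 s"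
    "(leaf_words (us ! i), leaf_words s) \<in> lenlex (lenlex R)"
  shows "(graft_words ws us, graft_words ws (us[i := s])) \<in> lenlex (lenlex R)"
proof -
  have irr: "irrefl (lenlex R)"
    using assms(1) by (meson irreflI irreflD lenlex_irreflexive)
  define as a bs where "as = take i us" and "a = us ! i" and "bs = drop (Suc i) us"
  have us: "us = as @ a # bs" "us[i := s] = as @ s # bs" "a = us ! i"
    using assms(3) unfolding as_def bs_def a_def
    by (simp_all add: id_take_nth_drop[symmetric] upd_conv_take_nth_drop)
  define xs x ys where "xs = take i ws" and "x = ws ! i" and "ys = drop (Suc i) ws"
  have ws: "ws = xs @ x # ys" "length xs = length as"
    using assms(2,3) unfolding as_def xs_def x_def ys_def
    by (simp_all add: id_take_nth_drop[symmetric])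
  have "(map ((@) x) (leaf_words a) @ graft_words ys bs, map ((@) x) (leaf_words s) @ graft_words ys bs)
          \<in> lenlex (lenlex R)"
    using assms(1,5) assms(4)[symmetric] unfolding us(3)[symmetric]
    by (intro lenlex_append1) (simp_all add: lenlex_map_append)
  moreover have "graft_words ws us = graft_words xs as @ map ((@) x) (leaf_words a) @ graft_words ys bs"
    unfolding us(1) ws(1) using ws(2) by (simp add: graft_words_append)
  moreover have "graft_words ws (us[i := s]) =
      graft_words xs as @ map ((@) x) (leaf_words s) @ graft_words ys bs"
    unfolding us(2) ws(1) using ws(2) by (simp add: graft_words_append)
  ultimately show ?thesis
    using irr by simp
qed

section \<open>The path order as a monomial order\<close>

definition path_order :: "'g rel \<Rightarrow> nat \<Rightarrow> 'g tree rel" where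
  "path_order R n = {(s, t). size1 s = n \<and> size1 t = n \<and>
     (s = t \<or> (leaf_words s, leaf_words t) \<in> lenlex (lenlex R))}"

lemma path_order_strict_iff:
  assumes "irrefl R"
  shows "(s, t) \<in> path_order R n - Id \<longleftrightarrow>
    size1 s = n \<and> size1 t = n \<and> (leaf_words s, leaf_words t) \<in> lenlex (lenlex R)"
proof -
  have "(ws, ws) \<notin> lenlex (lenlex R)" for ws
    using assms by (meson irreflD lenlex_irreflexive)
  then show ?thesis
    by (auto simp: path_order_def)
qed

text \<open>The order is pulled back along \<open>leaf_words\<close>. Well-foundedness and
  transitivity come from \<open>lenlex\<close>; injectivity of \<open>leaf_words\<close> turns
  totality on word lists into totality on trees.\<close>

lemma well_order_on_path_order:
  assumes "wf R" "trans R" "total R"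
  shows "well_order_on {t. size1 t = n} (path_order R n)"
proof -
  let ?Q = "lenlex (lenlex R)"
  have wf: "wf ?Q" and tr: "trans ?Q" and tot: "total ?Q"
    using assms by (auto intro: total_lenlex lenlex_transI)
  have "wf (path_order R n - Id)"
    using wf_inv_image[OF wf, of leaf_words]
    by (rule wf_subset) (auto simp: path_order_def)
  moreover have "linear_order_on {t. size1 t = n} (path_order R n)"
    unfolding linear_order_on_def partial_order_on_def preorder_on_def
  proof (intro conjI)
    show "trans (path_order R n)"
      using tr by (auto simp: path_order_def trans_def)
    show "antisym (path_order R n)"
      using wf wf_asym[OF wf] by (auto simp: path_order_def antisym_def)
    show "total_on {t. size1 t = n} (path_order R n)"
      using tot by (auto simp: path_order_def total_on_def leaf_words_inject)
  qed (auto simp: path_order_def refl_on_def)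
  ultimately show ?thesis
    by (simp add: well_order_on_def)
qed

lemma monomial_order_path_order:
  fixes R :: "'g rel"
  assumes "wf R" "trans R" "total R"
  shows "monomial_order (path_order R)"
proof -
  have irr: "irrefl R"
    using assms(1) by (simp add: irrefl_def wf_not_refl)
  show ?thesis
    unfolding monomial_order_def path_order_strict_iff[OF irr]
  proof (intro conjI allI impI)
    fix n show "well_order_on {t :: 'g tree. size1 t = n} (path_order R n)"
      using well_order_on_path_order[OF assms] .
  next
    fix n and s s' :: "'g tree" and us :: "'g tree list"
    assume *: "size1 s = n \<and> size1 s' = n \<and> (leaf_words s, leaf_words s') \<in> lenlex (lenlex R)"
      "length us = n"
    then have g: "leaf_words (graft s us) = graft_words (leaf_words s) us"
        "leaf_words (graft s' us) = graft_words (leaf_words s') us"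
      by (auto simp: leaf_words_graft)
    show "(leaf_words (graft s us), leaf_words (graft s' us)) \<in> lenlex (lenlex R)"
      unfolding g using * irr by (intro graft_words_strict_mono_left) auto
    show "size1 (graft s' us) = size1 (graft s us)"
      using * g by (metis length_graft_words length_leaf_words)
    show "size1 (graft s us) = size1 (graft s us)" ..
  next
    fix n i and t s' :: "'g tree" and us :: "'g tree list"
    assume *: "length us = size1 t" "i < length us"
      "size1 (us ! i) = n \<and> size1 s' = n \<and> (leaf_words (us ! i), leaf_words s') \<in> lenlex (lenlex R)"
    then have g: "leaf_words (graft t us) = graft_words (leaf_words t) us"
        "leaf_words (graft t (us[i := s'])) = graft_words (leaf_words t) (us[i := s'])"
      by (auto simp: leaf_words_graft)
    show "(leaf_words (graft t us), leaf_words (graft t (us[i := s']))) \<in> lenlex (lenlex R)"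
      unfolding g using * irr by (intro graft_words_strict_mono_right) auto
    have "map size1 (us[i := s']) = map size1 us"
      using * by (metis list_update_id map_update)
    then show "size1 (graft t (us[i := s'])) = size1 (graft t us)"
      using * g by (metis length_graft_words length_leaf_words length_list_update)
    show "size1 (graft t us) = size1 (graft t us)" ..
  qed
qed

section \<open>Reduction of lists of terms\<close>

definition of_terms :: "('g tree \<times> int) list \<Rightarrow> 'g tree \<Rightarrow>\<^sub>0 'k::field" where
  "of_terms ps = (\<Sum>(t, c)\<leftarrow>ps. Poly_Mapping.single t (of_int c))"

lemma of_terms_simps [simp]:
  "of_terms [] = 0"
  "of_terms ((t, c) # ps) = Poly_Mapping.single t (of_int c) + of_terms ps"
  "of_terms (ps @ qs) = of_terms ps + of_terms qs"
  by (simp_all add: of_terms_def)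

text \<open>The case \<open>c = 0\<close> returns the empty list so that a term that has cancelled
  creates no further work in the evaluation.\<close>

definition scale :: "int \<Rightarrow> ('g \<times> int) list \<Rightarrow> ('g \<times> int) list" where
  "scale c ps = (if c = 0 then [] else map (map_prod id ((*) c)) ps)"

definition coefficient :: "('g \<times> int) list \<Rightarrow> 'g \<Rightarrow> int" where
  "coefficient ps t = (\<Sum>(s, c)\<leftarrow>ps. if s = t then c else 0)"

lemma coefficient_simps [simp]:
  "coefficient [] t = 0"
  "coefficient ((s, c) # ps) t = (if s = t then c else 0) + coefficient ps t"
  by (simp_all add: coefficient_def)

text \<open>The link between computation and field: lists carry integers and may repeat a tree, and
  only the summed coefficient is mapped into \<open>'k\<close>. Equality of integer coefficients
  therefore suffices for equality of the elements denoted.\<close>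

lemma lookup_of_terms:
  "Poly_Mapping.lookup (of_terms ps :: 'g tree \<Rightarrow>\<^sub>0 'k::field) t = of_int (coefficient ps t)"
  by (induction ps) (auto simp: lookup_add lookup_single when_def)

lemma of_terms_eqI:
  assumes "\<And>t. coefficient ps t = coefficient qs t"
  shows "(of_terms ps :: 'g tree \<Rightarrow>\<^sub>0 'k::field) = of_terms qs"
  by (rule poly_mapping_eqI) (simp add: lookup_of_terms assms)

lemma coefficient_append [simp]: "coefficient (ps @ qs) t = coefficient ps t + coefficient qs t"
  by (simp add: coefficient_def)

lemma coefficient_scale [simp]: "coefficient (scale c ps) t = c * coefficient ps t"
  by (induction ps) (auto simp: scale_def algebra_simps)

definition eliminate :: "'g \<Rightarrow> ('g \<times> int) list \<Rightarrow> ('g \<times> int) list" where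
  "eliminate t ps = filter (\<lambda>p. fst p \<noteq> t) ps"

lemma coefficient_eliminate [simp]:
  "coefficient (eliminate t ps) s = (if s = t then 0 else coefficient ps s)"
  by (induction ps) (auto simp: eliminate_def)

lemma lin_ext_sum_superset:
  assumes "finite A" "Poly_Mapping.keys p \<subseteq> A"
  shows "lin_ext f p = (\<Sum>a\<in>A. Poly_Mapping.single (f a) (Poly_Mapping.lookup p a))"
  unfolding lin_ext_def using assms
  by (intro sum.mono_neutral_left) (auto simp: in_keys_iff)

lemma lin_ext_add: "lin_ext f (p + q) = lin_ext f p + lin_ext f q"
proof -
  let ?A = "Poly_Mapping.keys p \<union> Poly_Mapping.keys q"
  have "lin_ext f (p + q) = (\<Sum>a\<in>?A. Poly_Mapping.single (f a) (Poly_Mapping.lookup (p + q) a))"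
    by (rule lin_ext_sum_superset) (use keys_add[of p q] in auto)
  also have "\<dots> = lin_ext f p + lin_ext f q"
    by (simp add: lin_ext_sum_superset[of ?A] lookup_add single_add sum.distrib)
  finally show ?thesis .
qed

lemma lin_ext_single: "lin_ext f (Poly_Mapping.single a c) = Poly_Mapping.single (f a) c"
  by (simp add: lin_ext_def)

lemma lin_ext_of_terms: "lin_ext f (of_terms ps) = of_terms (map (map_prod f id) ps)"
proof (induction ps)
  case Nil
  show ?case by (simp add: lin_ext_def)
qed (auto simp: lin_ext_add lin_ext_single)

section \<open>Matching and rewriting of single trees\<close>

fun match :: "'g tree \<Rightarrow> 'g tree \<Rightarrow> 'g tree list option" where
  "match Leaf t = Some [t]"
| "match (Node l g r) Leaf = None"
| "match (Node l g r) (Node l' g' r') =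
     (if g = g' then
        case match l l' of None \<Rightarrow> None
        | Some us \<Rightarrow> map_option ((@) us) (match r r')
      else None)"

lemma match_SomeD: "match l t = Some us \<Longrightarrow> length us = size1 l \<and> graft l us = t"
proof (induction l t arbitrary: us rule: match.induct)
  case (3 l g r l' g' r')
  then show ?case by (fastforce split: if_splits option.splits)
qed auto

type_synonym 'g int_rule = "'g tree \<times> ('g tree \<times> int) list"

definition rule_of :: "'g int_rule \<Rightarrow> ('g, 'k::field) rule" where
  "rule_of = map_prod id of_terms"

fun rewrite_root :: "'g int_rule list \<Rightarrow> 'g tree \<Rightarrow> ('g tree \<times> int) list option" where
  "rewrite_root [] t = None"
| "rewrite_root ((l, q) # rs) t =
     (case match l t of None \<Rightarrow> rewrite_root rs t
      | Some us \<Rightarrow> Some (map (map_prod (\<lambda>m. graft m us) id) q))"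

fun rewrite :: "'g int_rule list \<Rightarrow> 'g tree \<Rightarrow> ('g tree \<times> int) list option" where
  "rewrite rs Leaf = rewrite_root rs Leaf"
| "rewrite rs (Node l g r) =
     (case rewrite_root rs (Node l g r) of Some ps \<Rightarrow> Some ps
      | None \<Rightarrow>
        (case rewrite rs l of Some ps \<Rightarrow> Some (map (map_prod (\<lambda>m. Node m g r) id) ps)
         | None \<Rightarrow> map_option (map (map_prod (\<lambda>m. Node l g m) id)) (rewrite rs r)))"

lemma rewrite_root_SomeD:
  assumes "rewrite_root rs t = Some ps"
  shows "\<exists>(l, q)\<in>set rs. \<exists>us. t = graft l us \<and> length us = size1 l \<and>
    ps = map (map_prod (\<lambda>m. graft m us) id) q"
  using assms
  by (induction rs) (fastforce split: option.splits dest: match_SomeD)+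

text \<open>\<open>rewrite\<close> does not record where it acted; the position is rebuilt along the
  recursion, one \<open>Left\<close> or \<open>Right\<close> per descent.\<close>

lemma rewrite_SomeD:
  assumes "rewrite rs t = Some ps"
  shows "\<exists>(l, q)\<in>set rs. \<exists>p us. subtree_at t p = Some (graft l us) \<and> length us = size1 l \<and>
    ps = map (map_prod (\<lambda>m. replace_at t p (graft m us)) id) q"
  using assms
proof (induction t arbitrary: ps)
  case Leaf
  then obtain l q us where "(l, q) \<in> set rs" "Leaf = graft l us" "length us = size1 l"
      "ps = map (map_prod (\<lambda>m. graft m us) id) q"
    using rewrite_root_SomeD by fastforce
  then show ?case
    by (intro bexI[of _ "(l, q)"]) (auto intro!: exI[of _ "[]"] exI[of _ us])
next
  case (Node t1 g t2)
  show ?case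
  proof (cases "rewrite_root rs (Node t1 g t2)")
    case (Some ps')
    with Node.prems have "rewrite_root rs (Node t1 g t2) = Some ps" by simp
    then obtain l q us where "(l, q) \<in> set rs" "Node t1 g t2 = graft l us" "length us = size1 l"
        "ps = map (map_prod (\<lambda>m. graft m us) id) q"
      using rewrite_root_SomeD by fastforce
    then show ?thesis
      by (intro bexI[of _ "(l, q)"]) (auto intro!: exI[of _ "[]"] exI[of _ us])
  next
    case None
    note root = this
    show ?thesis
    proof (cases "rewrite rs t1")
      case (Some ps1)
      from Node.IH(1)[OF Some] obtain l q p us where *: "(l, q) \<in> set rs"
          "subtree_at t1 p = Some (graft l us)" "length us = size1 l"
          "ps1 = map (map_prod (\<lambda>m. replace_at t1 p (graft m us)) id) q"
        by blast
      with Some root Node.prems show ?thesis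
        by (intro bexI[of _ "(l, q)"]) (auto intro!: exI[of _ "Left # p"] exI[of _ us])
    next
      case None
      with root Node.prems obtain ps2 where r: "rewrite rs t2 = Some ps2"
          and ps: "ps = map (map_prod (\<lambda>m. Node t1 g m) id) ps2"
        by auto
      from Node.IH(2)[OF r] obtain l q p us where *: "(l, q) \<in> set rs"
          "subtree_at t2 p = Some (graft l us)" "length us = size1 l"
          "ps2 = map (map_prod (\<lambda>m. replace_at t2 p (graft m us)) id) q"
        by blast
      with ps show ?thesis
        by (intro bexI[of _ "(l, q)"]) (auto intro!: exI[of _ "Right # p"] exI[of _ us])
    qed
  qed
qed

lemma rewrites_at_rule_ofI:
  assumes "subtree_at t p = Some (graft l us)" "length us = size1 l"
  shows "rewrites_at (rule_of (l, q)) p t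
    (of_terms (map (map_prod (\<lambda>m. replace_at t p (graft m us)) id) q))"
  using rewrites_at.intros[OF assms, of "of_terms q"]
  by (simp add: rule_of_def lin_ext_of_terms)

lemma rewrite_imp_rewrites_at:
  assumes "rewrite rs t = Some ps"
  shows "\<exists>\<rho>\<in>rule_of ` set rs. \<exists>p. rewrites_at \<rho> p t (of_terms ps)"
  using rewrite_SomeD[OF assms] by (fastforce intro: rewrites_at_rule_ofI)

text \<open>The closure stands for zero or one step: if the coefficient of \<open>t\<close> vanishes
  in the field, \<open>t\<close> is no key and no step is possible, but then both lists denote the
  same element.\<close>

lemma reduction_step_of_terms:
  assumes "rewrite rs t = Some ps"
  shows "(reduction_step (rule_of ` set rs))\<^sup>*\<^sup>*
    (of_terms qs :: 'g tree \<Rightarrow>\<^sub>0 'k::field) (of_terms (scale (coefficient qs t) ps @ eliminate t qs))"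
proof -
  let ?f = "of_terms qs :: 'g tree \<Rightarrow>\<^sub>0 'k" and ?c = "coefficient qs t"
  let ?g = "of_terms (scale ?c ps @ eliminate t qs) :: 'g tree \<Rightarrow>\<^sub>0 'k"
  \<comment> \<open>Coefficientwise, subtracting \<open>c\<close> times \<open>t - h\<close> removes
    \<open>t\<close> and adds \<open>c\<close> times the rewritten terms.\<close>
  have g: "?g = ?f - Poly_Mapping.map ((*) (Poly_Mapping.lookup ?f t))
      (Poly_Mapping.single t 1 - of_terms ps)"
  proof (rule poly_mapping_eqI)
    fix s
    show "Poly_Mapping.lookup ?g s = Poly_Mapping.lookup (?f - Poly_Mapping.map
        ((*) (Poly_Mapping.lookup ?f t)) (Poly_Mapping.single t 1 - of_terms ps)) s"
      by (auto simp: lookup_minus map.rep_eq lookup_single when_def lookup_add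
           lookup_of_terms algebra_simps simp flip: of_terms_simps(3))
  qed
  show ?thesis
  proof (cases "t \<in> Poly_Mapping.keys ?f")
    case True
    from rewrite_imp_rewrites_at[OF assms] obtain \<rho> p where
      "\<rho> \<in> rule_of ` set rs" "rewrites_at \<rho> p t (of_terms ps :: 'g tree \<Rightarrow>\<^sub>0 'k)"
      by blast
    from reduction_step.intros[OF this(1) True this(2)] show ?thesis
      unfolding g by (rule r_into_rtranclp)
  next
    case False
    then have "?g = ?f"
      unfolding g by (intro poly_mapping_eqI) (simp add: in_keys_iff lookup_minus map.rep_eq when_def)
    then show ?thesis by simp
  qed
qed

text \<open>
  \<open>n\<close> bounds the number of steps, and \<open>ns\<close> collects the terms found to be irreducible, which may
  still cancel against each other.
\<close>

fun reduces_in ::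
  "'g int_rule list \<Rightarrow> nat \<Rightarrow> ('g tree \<times> int) list \<Rightarrow> ('g tree \<times> int) list \<Rightarrow> bool" where
  "reduces_in rs n ns [] \<longleftrightarrow> (\<forall>(t, c)\<in>set ns. coefficient ns t = 0)"
| "reduces_in rs 0 ns (p # ps) \<longleftrightarrow> False"
| "reduces_in rs (Suc n) ns ((t, c) # ps) =
     (case rewrite rs t of
        None \<Rightarrow> reduces_in rs n ((t, c) # ns) ps
      | Some qs \<Rightarrow>
          reduces_in rs n (eliminate t ns) (scale (c + coefficient ps t + coefficient ns t) qs @ eliminate t ps))"

text \<open>The element denoted by \<open>ps @ ns\<close> is the invariant: setting an irreducible
  term aside only permutes the list, and rewriting a term is at most one reduction step. At the end
  all coefficients of \<open>ns\<close> vanish.\<close>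

lemma reduces_in_sound:
  "reduces_in rs n ns ps \<Longrightarrow>
     reduces_to_zero (rule_of ` set rs) (of_terms (ps @ ns) :: 'g tree \<Rightarrow>\<^sub>0 'k::field)"
proof (induction rs n ns ps rule: reduces_in.induct)
  case (1 rs n ns)
  have "coefficient ns t = 0" for t
  proof (cases "t \<in> fst ` set ns")
    case False
    then show ?thesis by (induction ns) auto
  qed (use 1 in auto)
  then have "(of_terms ns :: 'g tree \<Rightarrow>\<^sub>0 'k) = 0"
    by (metis of_terms_eqI of_terms_simps(1) coefficient_simps(1))
  then show ?case
    by (simp add: reduces_to_zero_def)
next
  case (3 rs n ns t c ps)
  show ?case
  proof (cases "rewrite rs t")
    case None
    with 3 have "reduces_to_zero (rule_of ` set rs) (of_terms (ps @ (t, c) # ns) :: 'g tree \<Rightarrow>\<^sub>0 'k)"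
      by simp
    then show ?thesis
      by (simp add: algebra_simps)
  next
    case (Some qs)
    let ?ps = "((t, c) # ps) @ ns"
    let ?qs = "scale (c + coefficient ps t + coefficient ns t) qs @ eliminate t ps @ eliminate t ns"
    \<comment> \<open>A reduction step acts on the whole coefficient of \<open>t\<close>, so its
      copies in \<open>ps\<close> and in \<open>ns\<close> are collected with the head term.\<close>
    have eq: "(of_terms (scale (coefficient ?ps t) qs @ eliminate t ?ps) :: 'g tree \<Rightarrow>\<^sub>0 'k) = of_terms ?qs"
      by (rule of_terms_eqI) simp
    have "reduces_to_zero (rule_of ` set rs) (of_terms ?qs :: 'g tree \<Rightarrow>\<^sub>0 'k)"
      using 3 Some by simp
    then show ?thesis
      unfolding reduces_to_zero_def eq[symmetric]
      by (rule rtranclp_trans[OF reduction_step_of_terms[OF Some]])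
  qed
qed simp

text \<open>An occurrence determines the substituted trees, so \<open>composition\<close> can
  recover them by matching.\<close>

lemma match_graft: "length us = size1 l \<Longrightarrow> match l (graft l us) = Some us"
proof (induction l arbitrary: us)
  case Leaf
  then show ?case by (auto simp: length_Suc_conv)
qed auto

section \<open>Reduction commutes with negation\<close>

lemma of_terms_scale_uminus: "of_terms (scale (- 1) ps) = - of_terms ps"
  by (induction ps) (auto simp: scale_def single_uminus)

lemma reduction_step_uminus: "reduction_step R f g \<Longrightarrow> reduction_step R (- f) (- g)"
proof (induction rule: reduction_step.induct)
  case (1 \<rho> T f p h)
  let ?d = "Poly_Mapping.single T 1 - h"
  have "- (f - Poly_Mapping.map ((*) (Poly_Mapping.lookup f T)) ?d) =
      - f - Poly_Mapping.map ((*) (Poly_Mapping.lookup (- f) T)) ?d"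
    by (rule poly_mapping_eqI) (simp add: lookup_minus map.rep_eq when_def)
  moreover have "T \<in> Poly_Mapping.keys (- f)"
    using 1 by simp
  ultimately show ?case
    using reduction_step.intros[of \<rho> R T "- f" p h] 1 by simp
qed

text \<open>Exchanging the two occurrences negates a composition, so only one order of each overlap
  has to be evaluated.\<close>

lemma reduces_to_zero_uminus:
  assumes "reduces_to_zero R f"
  shows "reduces_to_zero R (- f)"
proof -
  from assms have "(reduction_step R)\<^sup>*\<^sup>* f 0"
    by (simp add: reduces_to_zero_def)
  then have "(reduction_step R)\<^sup>*\<^sup>* (- f) (- 0)"
    by (induction rule: rtranclp_induct)
       (auto intro: rtranclp.rtrancl_into_rtrancl reduction_step_uminus)
  then show ?thesis
    by (simp add: reduces_to_zero_def)
qed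

section \<open>Critical compositions\<close>

lemma internal_vertices_simps [simp]:
  "internal_vertices Leaf = {}"
  "internal_vertices (Node l g r) =
     insert [] ((#) Left ` internal_vertices l \<union> (#) Right ` internal_vertices r)"
proof -
  show "internal_vertices (Leaf :: 'g tree) = {}"
    unfolding internal_vertices_def by (auto elim: subtree_at.elims)
  show "internal_vertices (Node l g r) =
     insert [] ((#) Left ` internal_vertices l \<union> (#) Right ` internal_vertices r)"
  proof (rule set_eqI)
    fix p
    show "p \<in> internal_vertices (Node l g r) \<longleftrightarrow>
        p \<in> insert [] ((#) Left ` internal_vertices l \<union> (#) Right ` internal_vertices r)"
    proof (cases p)
      case (Cons d q)
      then show ?thesis by (cases d) (auto simp: internal_vertices_def)
    qed (auto simp: internal_vertices_def)
  qed
qed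

lemma Nil_in_internal_vertices_iff [simp]: "[] \<in> internal_vertices t \<longleftrightarrow> t \<noteq> Leaf"
  by (cases t) auto

lemma subtree_at_Leaf [simp]: "subtree_at Leaf p = (if p = [] then Some Leaf else None)"
  by (cases p) auto

section \<open>The three rules and their minimal overlaps\<close>

definition rule_xy :: "gen int_rule" where
  "rule_xy = (\<x>(\<y>(\<star> \<star>) \<star>), [(\<y>(\<star> \<x>(\<star> \<star>)), 1)])"

definition rule_yy :: "gen int_rule" where
  "rule_yy = (\<y>(\<y>(\<star> \<star>) \<star>),
      [(\<y>(\<x>(\<star> \<star>) \<star>), - 1), (\<x>(\<x>(\<star> \<star>) \<star>), - 1), (\<y>(\<star> \<y>(\<star> \<star>)), 1),
       (\<x>(\<star> \<y>(\<star> \<star>)), 1), (\<x>(\<star> \<x>(\<star> \<star>)), 1)])"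

definition rule_xxx :: "gen int_rule" where
  "rule_xxx = (\<x>(\<x>(\<x>(\<star> \<star>) \<star>) \<star>),
      [(\<x>(\<x>(\<star> \<y>(\<star> \<star>)) \<star>), 1), (\<x>(\<x>(\<star> \<x>(\<star> \<star>)) \<star>), 1),
       (\<x>(\<x>(\<star> \<star>) \<x>(\<star> \<star>)), 1), (\<x>(\<star> \<y>(\<star> \<x>(\<star> \<star>))), - 1),
       (\<x>(\<star> \<x>(\<star> \<x>(\<star> \<star>))), - 1)])"

definition pre_as_rules :: "gen int_rule list" where
  "pre_as_rules = [rule_xy, rule_yy, rule_xxx]"

text \<open>An entry holds the rule applied at the root, the other rule, the position of the latter,
  and the overlap. On label words, a proper suffix of the first left-hand side is a prefix of the
  second.\<close>

definition minimal_overlaps :: "(gen int_rule \<times> gen int_rule \<times> pos \<times> gen tree) list" where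
  "minimal_overlaps =
    [(rule_xy, rule_yy, [Left], \<x>(\<y>(\<y>(\<star> \<star>) \<star>) \<star>)),
     (rule_yy, rule_yy, [Left], \<y>(\<y>(\<y>(\<star> \<star>) \<star>) \<star>)),
     (rule_xxx, rule_xxx, [Left], \<x>(\<x>(\<x>(\<x>(\<star> \<star>) \<star>) \<star>) \<star>)),
     (rule_xxx, rule_xy, [Left, Left], \<x>(\<x>(\<x>(\<y>(\<star> \<star>) \<star>) \<star>) \<star>)),
     (rule_xxx, rule_xxx, [Left, Left], \<x>(\<x>(\<x>(\<x>(\<x>(\<star> \<star>) \<star>) \<star>) \<star>) \<star>))]"

lemma minimal_overlaps_complete:
  assumes "r1 \<in> set pre_as_rules" "r2 \<in> set pre_as_rules" "(r1, []) \<noteq> (r2, p)"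
    and "T = graft (fst r1) us" "length us = size1 (fst r1)"
    and "subtree_at T p = Some (graft (fst r2) vs)" "length vs = size1 (fst r2)"
    and "occurrence_vertices (fst r1) [] \<inter> occurrence_vertices (fst r2) p \<noteq> {}"
    and "occurrence_vertices (fst r1) [] \<union> occurrence_vertices (fst r2) p = internal_vertices T"
  shows "(r1, r2, p, T) \<in> set minimal_overlaps"
proof -
  have iv: "internal_vertices (fst r1) \<subseteq> {[], [Left], [Left, Left]}"
    using assms(1) by (auto simp: pre_as_rules_def rule_xy_def rule_yy_def rule_xxx_def)
  \<comment> \<open>A shared vertex makes \<open>p\<close> a prefix of a vertex of the first left
    comb, which leaves three positions on the left spine.\<close>
  from assms(8) obtain q where q: "p @ q \<in> internal_vertices (fst r1)"
    by (auto simp: occurrence_vertices_def)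
  with iv have p: "p = [] \<or> p = [Left] \<or> p = [Left, Left]"
    by (auto simp: append_eq_Cons_conv)
  have r: "r1 = rule_xy \<or> r1 = rule_yy \<or> r1 = rule_xxx" "r2 = rule_xy \<or> r2 = rule_yy \<or> r2 = rule_xxx"
    using assms(1,2) by (auto simp: pre_as_rules_def)
  have cover: "s \<in> internal_vertices T \<longleftrightarrow>
      s \<in> internal_vertices (fst r1) \<or> s \<in> (@) p ` internal_vertices (fst r2)" for s
    using assms(9) by (auto simp: occurrence_vertices_def)
  \<comment> \<open>None of these positions is covered, unless it lies within one of the two occurrences on the
    leftmost path; this forces the grafted subtrees at them to be leaves.\<close>
  note off_comb = cover[of "[Right]"] cover[of "[Left, Right]"] cover[of "[Left, Left, Right]"]
    cover[of "[Left, Left, Left, Right]"] cover[of "[Left, Left, Left, Left, Right]"]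
    cover[of "[Left, Left, Left]"] cover[of "[Left, Left, Left, Left]"]
    cover[of "[Left, Left, Left, Left, Left]"]
  \<comment> \<open>Matching both patterns fixes the labels on the left spine and discards all other
    combinations by label clashes; the substituted trees are still arbitrary here.\<close>
  consider a b c d where
      "(r1, r2, p, T) = (rule_xy, rule_yy, [Left], \<x>(\<y>(\<y>(a b) c) d))"
    | a b c d where "(r1, r2, p, T) = (rule_yy, rule_yy, [Left], \<y>(\<y>(\<y>(a b) c) d))"
    | a b c d e where
      "(r1, r2, p, T) = (rule_xxx, rule_xxx, [Left], \<x>(\<x>(\<x>(\<x>(a b) c) d) e))"
    | a b c d e where
      "(r1, r2, p, T) = (rule_xxx, rule_xy, [Left, Left], \<x>(\<x>(\<x>(\<y>(a b) c) d) e))"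
    | a b c d e f where
      "(r1, r2, p, T) = (rule_xxx, rule_xxx, [Left, Left], \<x>(\<x>(\<x>(\<x>(\<x>(a b) c) d) e) f))"
    using p r assms(3-7) q
    by (elim disjE) (simp_all add: rule_xy_def rule_yy_def rule_xxx_def)
  then show ?thesis
    by cases (use off_comb in \<open>auto simp: minimal_overlaps_def rule_xy_def rule_yy_def rule_xxx_def\<close>)
qed

definition composition :: "'g int_rule \<Rightarrow> 'g int_rule \<Rightarrow> pos \<Rightarrow> 'g tree \<Rightarrow> ('g tree \<times> int) list" where
  "composition r1 r2 p T =
     map (map_prod (\<lambda>m. graft m (the (match (fst r1) T))) id) (snd r1) @
     scale (- 1) (map (map_prod (\<lambda>m. replace_at T p
       (graft m (the (match (fst r2) (the (subtree_at T p)))))) id) (snd r2))"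

text \<open>The number 500 bounds the terms processed per overlap and only has to be large enough
  for these five.\<close>

lemma minimal_overlaps_reduce:
  "\<forall>(r1, r2, p, T)\<in>set minimal_overlaps. reduces_in pre_as_rules 500 [] (composition r1 r2 p T)"
  by code_simp

lemma critical_composition_at_root:
  fixes h1 h2 :: "gen tree \<Rightarrow>\<^sub>0 'k::field"
  assumes "r1 \<in> set pre_as_rules" "r2 \<in> set pre_as_rules" "(r1, []) \<noteq> (r2, p)"
    and "rewrites_at (rule_of r1) [] T h1" "rewrites_at (rule_of r2) p T h2"
    and "occurrence_vertices (fst r1) [] \<inter> occurrence_vertices (fst r2) p \<noteq> {}"
    and "occurrence_vertices (fst r1) [] \<union> occurrence_vertices (fst r2) p = internal_vertices T"
  shows "reduces_to_zero (rule_of ` set pre_as_rules) (h1 - h2)"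
proof -
  from assms(4) obtain us where us: "T = graft (fst r1) us" "length us = size1 (fst r1)"
      "h1 = lin_ext (\<lambda>m. graft m us) (of_terms (snd r1))"
    by cases (auto simp: rule_of_def prod_eq_iff)
  from assms(5) obtain vs where vs: "subtree_at T p = Some (graft (fst r2) vs)"
      "length vs = size1 (fst r2)"
      "h2 = lin_ext (\<lambda>m. replace_at T p (graft m vs)) (of_terms (snd r2))"
    by cases (auto simp: rule_of_def prod_eq_iff)
  have "h1 - h2 = of_terms (composition r1 r2 p T)"
    using us vs by (simp add: composition_def match_graft lin_ext_of_terms of_terms_scale_uminus)
  moreover have "(r1, r2, p, T) \<in> set minimal_overlaps"
    using minimal_overlaps_complete[OF assms(1-3) us(1,2) vs(1,2) assms(6,7)] .
  ultimately show ?thesis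
    using minimal_overlaps_reduce reduces_in_sound[of pre_as_rules 500 "[]"] by fastforce
qed

lemma rewrites_at_pre_as_rules_internal:
  assumes "r \<in> set pre_as_rules" "rewrites_at (rule_of r) p T h"
  shows "[] \<in> internal_vertices T"
proof -
  from assms(2) obtain us where "subtree_at T p = Some (graft (fst r) us)"
    by cases (auto simp: rule_of_def prod_eq_iff)
  with assms(1) show ?thesis
    by (auto simp: pre_as_rules_def rule_xy_def rule_yy_def rule_xxx_def split: if_splits)
qed

lemma critical_composition_reduces:
  assumes "critical_composition (rule_of ` set pre_as_rules) (f :: gen tree \<Rightarrow>\<^sub>0 'k::field)"
  shows "reduces_to_zero (rule_of ` set pre_as_rules) f"
  using assms
proof cases
  case (1 \<rho>1 \<rho>2 p1 p2 T h1 h2)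
  then obtain r1 r2 where r: "\<rho>1 = rule_of r1" "r1 \<in> set pre_as_rules"
      "\<rho>2 = rule_of r2" "r2 \<in> set pre_as_rules"
    by auto
  have fst_rule: "fst (rule_of r) = fst r" for r :: "gen int_rule"
    by (simp add: rule_of_def)
  have "[] \<in> internal_vertices T"
    using rewrites_at_pre_as_rules_internal r 1 by blast
  \<comment> \<open>The root of \<open>T\<close> must be covered, and \<open>p @ q = []\<close>
    forces \<open>p = []\<close>.\<close>
  with 1 have "p1 = [] \<or> p2 = []"
    by (auto simp: occurrence_vertices_def)
  then show ?thesis
  proof
    assume "p1 = []"
    with critical_composition_at_root[of r1 r2 p2 T h1 h2] 1 r show ?thesis
      by (auto simp: fst_rule)
  \<comment> \<open>With the second occurrence at the root the roles are swapped, which gives the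
    negated composition.\<close>
  next
    assume "p2 = []"
    with critical_composition_at_root[of r2 r1 p1 T h2 h1] 1 r
    have "reduces_to_zero (rule_of ` set pre_as_rules) (h2 - h1)"
      by (auto simp: fst_rule Int_commute Un_commute)
    then show ?thesis
      using reduces_to_zero_uminus 1 by fastforce
  qed
qed

text \<open>The first leaf word decides. For the left-hand sides it is \<open>xy\<close>,
  \<open>yy\<close>, \<open>xxx\<close>; on the right it is shorter, except for \<open>yx\<close>
  and \<open>xx\<close> in the second rule, which are smaller because \<open>x < y\<close>.\<close>

lemma pre_as_rules_decrease:
  assumes "\<rho> \<in> rule_of ` set pre_as_rules" "m \<in> Poly_Mapping.keys (snd \<rho> :: gen tree \<Rightarrow>\<^sub>0 'k::field)"
  shows "(m, fst \<rho>) \<in> path_order {(Gen_x, Gen_y)} (size1 (fst \<rho>)) - Id"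
proof -
  have irr: "irrefl {(Gen_x, Gen_y)}" by (simp add: irrefl_def)
  from assms(1) obtain r where r: "r \<in> set pre_as_rules" "\<rho> = rule_of r" by auto
  \<comment> \<open>Every key of a right-hand side is a listed tree, which leaves finitely many
    explicit comparisons.\<close>
  have "coefficient ps t = 0" if "t \<notin> fst ` set ps" for t and ps :: "(gen tree \<times> int) list"
    using that by (induction ps) auto
  moreover have "coefficient (snd r) m \<noteq> 0"
    using assms(2) r(2) by (auto simp: rule_of_def in_keys_iff lookup_of_terms)
  ultimately have "m \<in> fst ` set (snd r)"
    by blast
  with r show ?thesis
    unfolding path_order_strict_iff[OF irr]
    by (auto simp: rule_of_def pre_as_rules_def rule_xy_def rule_yy_def rule_xxx_def Cons_lenlex_iff)
qed

theorem theorem2: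
  shows "groebner_shirshov_basis
    ({(\<x>(\<y>(\<star> \<star>) \<star>),
       \<lbrakk>\<y>(\<star> \<x>(\<star> \<star>))\<rbrakk>),
      (\<y>(\<y>(\<star> \<star>) \<star>),
       - \<lbrakk>\<y>(\<x>(\<star> \<star>) \<star>)\<rbrakk> - \<lbrakk>\<x>(\<x>(\<star> \<star>) \<star>)\<rbrakk> + \<lbrakk>\<y>(\<star> \<y>(\<star> \<star>))\<rbrakk>
         + \<lbrakk>\<x>(\<star> \<y>(\<star> \<star>))\<rbrakk> + \<lbrakk>\<x>(\<star> \<x>(\<star> \<star>))\<rbrakk>),
      (\<x>(\<x>(\<x>(\<star> \<star>) \<star>) \<star>),
       \<lbrakk>\<x>(\<x>(\<star> \<y>(\<star> \<star>)) \<star>)\<rbrakk> + \<lbrakk>\<x>(\<x>(\<star> \<x>(\<star> \<star>)) \<star>)\<rbrakk> + \<lbrakk>\<x>(\<x>(\<star> \<star>) \<x>(\<star> \<star>))\<rbrakk>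
         - \<lbrakk>\<x>(\<star> \<y>(\<star> \<x>(\<star> \<star>)))\<rbrakk> - \<lbrakk>\<x>(\<star> \<x>(\<star> \<x>(\<star> \<star>)))\<rbrakk>)}
     :: (gen, 'k::field_char_0) rule set)" (is "groebner_shirshov_basis ?R")
proof -
  have R: "?R = rule_of ` set pre_as_rules"
    by (simp add: pre_as_rules_def rule_of_def rule_xy_def rule_yy_def rule_xxx_def
        single_uminus algebra_simps)
  have total: "total {(Gen_x, Gen_y)}"
    unfolding total_on_def by (metis gen.exhaust insertI1)
  have "monomial_order (path_order {(Gen_x, Gen_y)})"
    by (rule monomial_order_path_order) (auto simp: wf_insert trans_def total)
  then show ?thesis
    unfolding groebner_shirshov_basis_def R
    using pre_as_rules_decrease critical_composition_reduces by fastforce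
qed

end
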